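(* Let $r\in\mathbb R$ and $n\ge \frac15$. Let $\mu_0,\mu_1,\dots,\mu_\ell$ be the sequence of distributions obtained by applying a weight-constrained sequence of moves to an initial distribution $\mu_0$ with $\mu_0\{x>r\}=0$. If $\mu_{\max}\{x>r\}\le n$, then $\mu_{\max}\{x>r+6n^{1/3}-1\}=0$.
   Context: A (discrete mass) distribution is a finite set $\mu=\{(x_1,m_1),\dots,(x_k,m_k)\}$ with $x_i\in\mathbb R$ and $m_i>0$; a signed distribution is the same without the positivity requirement. For $A\subseteq\mathbb R$, $\mu(A)=\sum_{x_i\in A}m_i$, and $\mu\{x>a\}$ means $\mu(\{x:x>a\})$, etc. Moments: $M_j[\mu]=\sum_i m_ix_i^j$. A move $v=([a,b],\delta)$ consists of an interval with $b-a=1$ and a signed distribution $\delta$ supported in $[a,b]$ with $M_0[\delta]=M_1[\delta]=0$; its center is $\frac{a+b}2$. It can be applied to $\mu$ if $\mu+\delta$ is a distribution, and then $v\mu=\mu+\delta$. A sequence of moves $v_1,\dots,v_\ell$ applied to $\mu_0$ produces $\mu_i=v_i\mu_{i-1}$. For such a sequence, $\mu_{\max}\{x>a\}=\max_{0\le i\le\ell}\mu_i\{x>a\}$ (similarly for $\ge$). The sequence is weight-constrained (with respect to $\mu_0$) if for every $a\in\mathbb R$ the number of moves whose center lies in $(a,\infty)$ is at most $\mu_{\max}\{x>a\}$. *)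

theory Defs
  imports Complex_Main
begin

text \<open>A (signed) distribution is represented by its mass function
  \<open>real \<Rightarrow> real\<close> with finite support: the point x carries mass \<open>mu x\<close>
  (points with mass 0 are not part of the distribution).\<close>

definition signed_dist :: "(real \<Rightarrow> real) \<Rightarrow> bool" where
  "signed_dist d \<longleftrightarrow> finite {x. d x \<noteq> 0}"

definition is_dist :: "(real \<Rightarrow> real) \<Rightarrow> bool" where
  "is_dist mu \<longleftrightarrow> signed_dist mu \<and> (\<forall>x. 0 \<le> mu x)"

definition mass :: "(real \<Rightarrow> real) \<Rightarrow> real set \<Rightarrow> real" where
  "mass mu A = (\<Sum>x \<in> {x. mu x \<noteq> 0} \<inter> A. mu x)"

definition moment :: "nat \<Rightarrow> (real \<Rightarrow> real) \<Rightarrow> real" where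
  "moment j mu = (\<Sum>x \<in> {x. mu x \<noteq> 0}. mu x * x ^ j)"

definition is_move :: "real \<times> (real \<Rightarrow> real) \<Rightarrow> bool" where
  "is_move v \<longleftrightarrow> signed_dist (snd v)
     \<and> (\<forall>x. snd v x \<noteq> 0 \<longrightarrow> fst v \<le> x \<and> x \<le> fst v + 1)
     \<and> moment 0 (snd v) = 0 \<and> moment 1 (snd v) = 0"

definition center :: "real \<times> (real \<Rightarrow> real) \<Rightarrow> real" where
  "center v = fst v + 1/2"

definition seq_dist :: "(real \<Rightarrow> real) \<Rightarrow> (real \<times> (real \<Rightarrow> real)) list \<Rightarrow> nat \<Rightarrow> real \<Rightarrow> real" where
  "seq_dist mu0 vs i = (\<lambda>x. mu0 x + (\<Sum>j<i. snd (vs ! j) x))"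

definition valid_seq :: "(real \<Rightarrow> real) \<Rightarrow> (real \<times> (real \<Rightarrow> real)) list \<Rightarrow> bool" where
  "valid_seq mu0 vs \<longleftrightarrow> (\<forall>v \<in> set vs. is_move v)
     \<and> (\<forall>i \<le> length vs. is_dist (seq_dist mu0 vs i))"

definition mu_max :: "(real \<Rightarrow> real) \<Rightarrow> (real \<times> (real \<Rightarrow> real)) list \<Rightarrow> real set \<Rightarrow> real" where
  "mu_max mu0 vs A = Max ((\<lambda>i. mass (seq_dist mu0 vs i) A) ` {0..length vs})"

definition weight_constrained :: "(real \<Rightarrow> real) \<Rightarrow> (real \<times> (real \<Rightarrow> real)) list \<Rightarrow> bool" where
  "weight_constrained mu0 vs \<longleftrightarrow>
     (\<forall>a. real (card {i. i < length vs \<and> center (vs ! i) > a}) \<le> mu_max mu0 vs {a<..})"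

end

theory Submission
  imports Defs "HOL-Analysis.Analysis"
begin

text \<open>
  Put \<open>s = n powr (1/3)\<close>. If \<open>s \<le> 9/4\<close>, then the at most \<open>n\<close> moves centred beyond \<open>r\<close> carry mass at most
  to \<open>r + n + 1/2 \<le> r + 6 s - 1\<close>. Otherwise we show that at most mass \<open>n/8\<close> ever gets beyond \<open>r + 3 s\<close> and
  iterate with \<open>(r + 3 s, n/8)\<close>, that is with \<open>s/2\<close> for \<open>s\<close>.

  For the latter, consider the convex function \<open>U y = \<Sum>x. \<mu> x * (x - y)\<^sup>+\<close>. A move on \<open>[a, a + 1]\<close> changes \<open>U\<close>
  only inside the interval, where it stays below the chord, and the slope of \<open>U\<close> beyond \<open>r\<close> is at least \<open>-n\<close>.
  With \<open>z = r + 1\<close> it follows that \<open>U\<close> is dominated by \<open>W y = \<integral>\<^sub>y G\<close>, where the decreasing function \<open>G\<close>, equal to \<open>n\<close>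
  left of \<open>z\<close> and initially 0 right of \<open>z\<close>, is averaged over \<open>[a, a + 1]\<close> and then reset to \<open>n\<close> left of \<open>z\<close> at each
  move that reaches beyond \<open>z\<close>. Each such step lowers the energy \<open>\<integral> G (2 n - G - 6 s\<^sup>2 (y - z)\<^sup>+)\<close> by at most
  \<open>3/4 * s\<^sup>4\<close>, and there are at most \<open>n\<close> of them. This bounds the first moment of \<open>G\<close> from above,
  whereas mass \<open>n/8\<close> beyond \<open>r + 3 s\<close> would force \<open>U\<close>, hence \<open>W\<close> and this moment, to be too large.
\<close>

section \<open>The excess function\<close>

text \<open>For a distribution this is the integral of \<open>mass mu {t<..}\<close> over
  \<open>t > y\<close>: convex in \<open>y\<close>, with right slope
  \<open>- mass mu {y<..}\<close>.\<close>

definition excess :: "(real \<Rightarrow> real) \<Rightarrow> real \<Rightarrow> real" where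
  "excess mu y = (\<Sum>x | mu x \<noteq> 0. mu x * max 0 (x - y))"

lemma excess_superset:
  assumes "finite S" "{x. mu x \<noteq> 0} \<subseteq> S"
  shows "excess mu y = (\<Sum>x\<in>S. mu x * max 0 (x - y))"
  unfolding excess_def by (rule sum.mono_neutral_left) (use assms in auto)

lemma excess_add:
  assumes "signed_dist mu" "signed_dist d"
  shows "excess (\<lambda>x. mu x + d x) y = excess mu y + excess d y"
proof -
  let ?S = "{x. mu x \<noteq> 0} \<union> {x. d x \<noteq> 0}"
  have fin: "finite ?S"
    using assms by (simp add: signed_dist_def)
  show ?thesis
    by (subst (1 2 3) excess_superset[OF fin]) (auto simp: sum.distrib distrib_right)
qed

lemma excess_nonneg: "is_dist mu \<Longrightarrow> 0 \<le> excess mu y"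
  unfolding excess_def is_dist_def by (intro sum_nonneg) auto

lemma excess_antimono:
  assumes "is_dist mu" "y \<le> y'"
  shows "excess mu y' \<le> excess mu y"
  unfolding excess_def using assms
  by (intro sum_mono mult_left_mono) (auto simp: is_dist_def)

lemma excess_chord:
  assumes "is_dist mu" "a \<le> y" "y \<le> a + 1"
  shows "excess mu y \<le> (a + 1 - y) * excess mu a + (y - a) * excess mu (a + 1)"
proof -
  have "max 0 (x - y) \<le> (a + 1 - y) * max 0 (x - a) + (y - a) * max 0 (x - (a + 1))" for x
  proof -
    have "x - y = (a + 1 - y) * (x - a) + (y - a) * (x - (a + 1))"
      by algebra
    also have "\<dots> \<le> (a + 1 - y) * max 0 (x - a) + (y - a) * max 0 (x - (a + 1))"
      using assms by (intro add_mono mult_left_mono) auto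
    finally show ?thesis
      using assms by simp
  qed
  then have "excess mu y \<le> (\<Sum>x | mu x \<noteq> 0.
      mu x * ((a + 1 - y) * max 0 (x - a) + (y - a) * max 0 (x - (a + 1))))"
    unfolding excess_def using assms
    by (intro sum_mono mult_left_mono) (auto simp: is_dist_def)
  then show ?thesis
    by (simp add: excess_def sum_distrib_left distrib_left sum.distrib mult.left_commute)
qed

lemma mass_greaterThan_eq_sum:
  assumes "is_dist mu"
  shows "mass mu {a<..} = (\<Sum>x | mu x \<noteq> 0. mu x * (if a < x then 1 else 0))"
proof -
  have "finite {x. mu x \<noteq> 0}"
    using assms by (simp add: is_dist_def signed_dist_def)
  then have "mass mu {a<..} = (\<Sum>x | mu x \<noteq> 0. if x \<in> {a<..} then mu x else 0)"
    unfolding mass_def by (rule sum.inter_restrict)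
  also have "\<dots> = (\<Sum>x | mu x \<noteq> 0. mu x * (if a < x then 1 else 0))"
    by (rule sum.cong) auto
  finally show ?thesis .
qed

text \<open>Passing from \<open>y\<close> to \<open>z\<close>, only points beyond \<open>y\<close>
  contribute to the loss, each at most \<open>z - y\<close> per unit mass.\<close>

lemma excess_le_mass:
  assumes "is_dist mu" "y \<le> z"
  shows "excess mu y \<le> excess mu z + (z - y) * mass mu {y<..}"
proof -
  have "excess mu y \<le> (\<Sum>x | mu x \<noteq> 0. mu x * (max 0 (x - z) + (z - y) * (if y < x then 1 else 0)))"
    unfolding excess_def using assms
    by (intro sum_mono mult_left_mono) (auto simp: is_dist_def)
  also have "\<dots> = excess mu z + (z - y) * mass mu {y<..}"
    by (simp add: mass_greaterThan_eq_sum[OF assms(1)] excess_def sum.distrib distrib_left sum_distrib_left mult.left_commute)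
  finally show ?thesis .
qed

text \<open>Markov's inequality for the distance beyond \<open>y\<close>.\<close>

lemma mass_le_excess:
  assumes "is_dist mu" "y \<le> z"
  shows "(z - y) * mass mu {z<..} \<le> excess mu y"
proof -
  have "(z - y) * mass mu {z<..} = (\<Sum>x | mu x \<noteq> 0. mu x * ((z - y) * (if z < x then 1 else 0)))"
    by (simp add: mass_greaterThan_eq_sum[OF assms(1)] sum_distrib_left mult.left_commute)
  also have "\<dots> \<le> excess mu y"
    unfolding excess_def using assms
    by (intro sum_mono mult_left_mono) (auto simp: is_dist_def)
  finally show ?thesis .
qed

lemma mass_antimono:
  assumes "is_dist mu" "a \<le> b"
  shows "mass mu {b<..} \<le> mass mu {a<..}"
  unfolding mass_greaterThan_eq_sum[OF assms(1)] using assms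
  by (intro sum_mono mult_left_mono) (auto simp: is_dist_def)

text \<open>Both vanish exactly when no point lies beyond \<open>a\<close>; this translates
  hypothesis and conclusion of the theorem into statements on \<open>excess\<close>.\<close>

lemma mass_eq_0_iff_excess_eq_0:
  assumes "is_dist mu"
  shows "mass mu {a<..} = 0 \<longleftrightarrow> excess mu a = 0"
proof -
  have "finite {x. mu x \<noteq> 0}" "\<And>x. 0 \<le> mu x"
    using assms by (auto simp: is_dist_def signed_dist_def)
  moreover have "max 0 (x - a) = 0 \<longleftrightarrow> x \<le> a" for x
    by auto
  ultimately have "mass mu {a<..} = 0 \<longleftrightarrow> (\<forall>x. mu x \<noteq> 0 \<longrightarrow> x \<le> a)"
      and "excess mu a = 0 \<longleftrightarrow> (\<forall>x. mu x \<noteq> 0 \<longrightarrow> x \<le> a)"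
    unfolding mass_greaterThan_eq_sum[OF assms] excess_def
    by (subst sum_nonneg_eq_0_iff; auto simp: not_less)+
  then show ?thesis
    by simp
qed

section \<open>Effect of moves on the excess\<close>

text \<open>For \<open>y\<close> left of the interval, \<open>max 0 (x - y)\<close> is affine on the
  support, so the two vanishing moments kill it; for \<open>y\<close> right of it, it is 0 on the
  support.\<close>

lemma excess_move_outside:
  assumes "is_move (a, d)" "y \<le> a \<or> a + 1 \<le> y"
  shows "excess d y = 0"
  using assms(2)
proof
  assume "y \<le> a"
  then have "excess d y = (\<Sum>x | d x \<noteq> 0. d x * (x - y))"
    unfolding excess_def using assms(1) by (intro sum.cong) (auto simp: is_move_def)
  also have "\<dots> = moment 1 d - y * moment 0 d"
    by (simp add: moment_def right_diff_distrib sum_subtractf sum_distrib_left mult.commute)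
  finally show ?thesis
    using assms(1) by (simp add: is_move_def)
next
  assume "a + 1 \<le> y"
  then show ?thesis
    unfolding excess_def using assms(1) by (intro sum.neutral) (auto simp: is_move_def)
qed

lemma seq_dist_0: "seq_dist mu0 vs 0 = mu0"
  by (simp add: seq_dist_def)

lemma valid_seq_is_dist: "valid_seq mu0 vs \<Longrightarrow> i \<le> length vs \<Longrightarrow> is_dist (seq_dist mu0 vs i)"
  by (simp add: valid_seq_def)

lemma excess_seq_Suc_outside:
  assumes "valid_seq mu0 vs" "i < length vs"
    and "y \<le> fst (vs ! i) \<or> fst (vs ! i) + 1 \<le> y"
  shows "excess (seq_dist mu0 vs (Suc i)) y = excess (seq_dist mu0 vs i) y"
proof -
  have mv: "is_move (fst (vs ! i), snd (vs ! i))"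
    using assms(1,2) by (simp add: valid_seq_def)
  have "excess (seq_dist mu0 vs (Suc i)) y
      = excess (\<lambda>x. seq_dist mu0 vs i x + snd (vs ! i) x) y"
    by (simp add: seq_dist_def add.assoc)
  also have "\<dots> = excess (seq_dist mu0 vs i) y + excess (snd (vs ! i)) y"
    using valid_seq_is_dist[OF assms(1), of i] assms(2) mv
    by (intro excess_add) (auto simp: is_dist_def is_move_def)
  finally show ?thesis
    using excess_move_outside[OF mv assms(3)] by simp
qed

text \<open>The new excess is convex and keeps its old values at both ends of the interval.\<close>

lemma excess_seq_Suc_inside:
  assumes "valid_seq mu0 vs" "i < length vs"
    and "fst (vs ! i) \<le> y" "y \<le> fst (vs ! i) + 1"
  shows "excess (seq_dist mu0 vs (Suc i)) y \<le>
    (fst (vs ! i) + 1 - y) * excess (seq_dist mu0 vs i) (fst (vs ! i))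
    + (y - fst (vs ! i)) * excess (seq_dist mu0 vs i) (fst (vs ! i) + 1)"
  using excess_chord[OF valid_seq_is_dist[OF assms(1), of "Suc i"] assms(3,4)] assms(2)
  by (simp add: excess_seq_Suc_outside[OF assms(1,2)])

section \<open>Counting moves, and the front they can reach\<close>

definition moves_beyond :: "(real \<times> (real \<Rightarrow> real)) list \<Rightarrow> real \<Rightarrow> nat \<Rightarrow> nat" where
  "moves_beyond vs r i = card {j. j < i \<and> center (vs ! j) > r}"

lemma moves_beyond_0: "moves_beyond vs r 0 = 0"
  by (simp add: moves_beyond_def)

lemma moves_beyond_Suc:
  "moves_beyond vs r (Suc i) = moves_beyond vs r i + (if center (vs ! i) > r then 1 else 0)"
proof -
  have "{j. j < Suc i \<and> center (vs ! j) > r} =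
    (if center (vs ! i) > r then insert i {j. j < i \<and> center (vs ! j) > r}
     else {j. j < i \<and> center (vs ! j) > r})"
    by (auto simp: less_Suc_eq)
  then show ?thesis
    by (simp add: moves_beyond_def)
qed

lemma moves_beyond_mono: "i \<le> k \<Longrightarrow> moves_beyond vs r i \<le> moves_beyond vs r k"
  unfolding moves_beyond_def by (intro card_mono) auto

lemma mass_le_mu_max: "i \<le> length vs \<Longrightarrow> mass (seq_dist mu0 vs i) A \<le> mu_max mu0 vs A"
  unfolding mu_max_def by (intro Max_ge) auto

lemma mu_max_le_iff:
  "mu_max mu0 vs A \<le> c \<longleftrightarrow> (\<forall>i\<le>length vs. mass (seq_dist mu0 vs i) A \<le> c)"
  unfolding mu_max_def by (subst Max_le_iff) auto

lemma moves_beyond_le_mu_max: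
  assumes "weight_constrained mu0 vs" "i \<le> length vs"
  shows "real (moves_beyond vs r i) \<le> mu_max mu0 vs {r<..}"
proof -
  have "moves_beyond vs r i \<le> moves_beyond vs r (length vs)"
    by (rule moves_beyond_mono[OF assms(2)])
  then have "real (moves_beyond vs r i) \<le> real (moves_beyond vs r (length vs))"
    by simp
  also have "\<dots> \<le> mu_max mu0 vs {r<..}"
    using assms(1) by (simp add: weight_constrained_def moves_beyond_def)
  finally show ?thesis .
qed

text \<open>A move centred at most at \<open>r\<close> ends by \<open>r + 1/2\<close>, behind the
  front. Any other move advances the front by 1, and an interval meeting the region beyond the new
  front starts beyond the old one, where the chord is 0.\<close>

lemma excess_beyond_moves_eq_0:
  assumes "valid_seq mu0 vs" "excess mu0 r = 0" "i \<le> length vs"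
    and "r + 1/2 + moves_beyond vs r i \<le> y"
  shows "excess (seq_dist mu0 vs i) y = 0"
  using assms(3,4)
proof (induction i arbitrary: y)
  case 0
  have "is_dist mu0"
    using valid_seq_is_dist[OF assms(1), of 0] by (simp add: seq_dist_0)
  then show ?case
    using excess_antimono[of mu0 r y] excess_nonneg[of mu0 y] assms(2) 0
    by (simp add: seq_dist_0)
next
  case (Suc i)
  let ?a = "fst (vs ! i)"
  have i: "i < length vs"
    using Suc.prems by simp
  have IH: "excess (seq_dist mu0 vs i) u = 0" if "r + 1/2 + moves_beyond vs r i \<le> u" for u
    using Suc.IH i that by simp
  have y: "excess (seq_dist mu0 vs i) y = 0"
    using IH Suc.prems(2) by (simp add: moves_beyond_Suc split: if_splits)
  show ?case
  proof (cases "y \<le> ?a \<or> ?a + 1 \<le> y")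
    case True
    then show ?thesis
      using excess_seq_Suc_outside[OF assms(1) i True] y by simp
  next
    case False
    then have "?a < y" "y < ?a + 1"
      by auto
    moreover from this have "center (vs ! i) > r"
      using Suc.prems(2) by (simp add: center_def)
    ultimately have "r + 1/2 + moves_beyond vs r i \<le> ?a"
      using Suc.prems(2) by (simp add: moves_beyond_Suc)
    then have "excess (seq_dist mu0 vs (Suc i)) y \<le> 0"
      using excess_seq_Suc_inside[OF assms(1) i, of y] False IH[of ?a] IH[of "?a + 1"] by simp
    then show ?thesis
      using excess_nonneg[OF valid_seq_is_dist[OF assms(1) Suc.prems(1)]] by (simp add: order_antisym)
  qed
qed

section \<open>Profiles\<close>

text \<open>A stand-in for the tail mass function. Its integrals are taken over bounded intervals,
  so no support condition appears.\<close>

definition profile :: "real \<Rightarrow> real \<Rightarrow> (real \<Rightarrow> real) \<Rightarrow> bool" where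
  "profile n z G \<longleftrightarrow> antimono G \<and> (\<forall>y\<le>z. G y = n) \<and> (\<forall>y. 0 \<le> G y)"

lemma profileD:
  assumes "profile n z G"
  shows "x \<le> y \<Longrightarrow> G y \<le> G x" "y \<le> z \<Longrightarrow> G y = n" "0 \<le> G y" "G y \<le> n"
proof -
  show *: "x \<le> y \<Longrightarrow> G y \<le> G x" for x y
    using assms by (auto simp: profile_def antimono_def)
  show "y \<le> z \<Longrightarrow> G y = n" "0 \<le> G y"
    using assms by (auto simp: profile_def)
  have "G (min y z) = n"
    using assms by (simp add: profile_def)
  then show "G y \<le> n"
    using *[of "min y z" y] by simp
qed

lemma profile_measurable:
  assumes "profile n z G"
  shows "G \<in> borel_measurable borel"
proof -
  have "(\<lambda>y. - G y) \<in> borel_measurable borel"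
    using profileD(1)[OF assms] by (intro borel_measurable_mono) (auto simp: mono_def)
  then show ?thesis
    using borel_measurable_uminus_eq by blast
qed

lemma bounded_measurable_integrable_on:
  fixes f :: "real \<Rightarrow> real"
  assumes "f \<in> borel_measurable borel" "\<And>x. x \<in> {a..b} \<Longrightarrow> \<bar>f x\<bar> \<le> B"
  shows "f integrable_on {a..b}"
proof (rule measurable_bounded_by_integrable_imp_integrable)
  show "f \<in> borel_measurable (lebesgue_on {a..b})"
    using assms(1) by (simp add: borel_measurable_if_I measurable_completion measurable_restrict_space1)
  show "(\<lambda>x. B) integrable_on {a..b}"
    by (rule integrable_const_ivl)
  show "norm (f x) \<le> B" if "x \<in> {a..b}" for x
    using assms(2)[OF that] by simp
qed auto

lemma continuous_times_profile_integrable_on: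
  assumes "profile n z G" "continuous_on UNIV (h :: real \<Rightarrow> real)"
  shows "(\<lambda>y. h y * G y) integrable_on {a..b}"
proof -
  have "bounded (h ` {a..b})"
    using assms(2) by (intro compact_imp_bounded compact_continuous_image)
      (auto intro: continuous_on_subset)
  then obtain B where "\<forall>y\<in>{a..b}. \<bar>h y\<bar> \<le> B"
    unfolding bounded_iff by auto
  then have B: "\<And>y. y \<in> {a..b} \<Longrightarrow> \<bar>h y\<bar> \<le> B"
    by blast
  show ?thesis
  proof (rule bounded_measurable_integrable_on)
    show "(\<lambda>y. h y * G y) \<in> borel_measurable borel"
      using profile_measurable[OF assms(1)] borel_measurable_continuous_onI[OF assms(2)]
      by measurable
    show "\<bar>h y * G y\<bar> \<le> B * n" if "y \<in> {a..b}" for y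
      unfolding abs_mult using B[OF that] profileD[OF assms(1)]
      by (intro mult_mono) (auto intro: order_trans[of _ "\<bar>h y\<bar>"])
  qed
qed

lemma profile_integrable_on: "profile n z G \<Longrightarrow> G integrable_on {a..b}"
  using continuous_times_profile_integrable_on[of n z G "\<lambda>_. 1"] by simp

lemma profile_integral_split:
  assumes "profile n z G" "a \<le> b" "b \<le> c"
  shows "integral {a..c} G = integral {a..b} G + integral {b..c} G"
  using Henstock_Kurzweil_Integration.integral_combine[OF assms(2,3) profile_integrable_on[OF assms(1)]]
  by simp

lemma profile_integral_bounds:
  assumes "profile n z G"
  shows "integral {a..a+1} G \<le> G a" "G (a + 1) \<le> integral {a..a+1} G"
proof -
  have "integral {a..a+1} G \<le> integral {a..a+1} (\<lambda>_. G a)"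
    using assms by (intro integral_le profile_integrable_on[OF assms]) (auto intro: profileD)
  then show "integral {a..a+1} G \<le> G a"
    by simp
  have "integral {a..a+1} (\<lambda>_. G (a + 1)) \<le> integral {a..a+1} G"
    using assms by (intro integral_le profile_integrable_on[OF assms]) (auto intro: profileD)
  then show "G (a + 1) \<le> integral {a..a+1} G"
    by simp
qed

text \<open>Averaging over \<open>[a, a + 1]\<close> is what the most spreading move on that interval does to the tail
  function of a distribution; resetting the value left of \<open>z\<close> replaces mass that fell off to the left.\<close>

definition level :: "real \<Rightarrow> real \<Rightarrow> real \<Rightarrow> (real \<Rightarrow> real) \<Rightarrow> real \<Rightarrow> real" where
  "level n z a G y = (if y \<le> z then n else if y \<in> {a..a+1} then integral {a..a+1} G else G y)"

lemma profile_level: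
  assumes G: "profile n z G"
  shows "profile n z (level n z a G)"
proof -
  note D = profileD[OF G]
  note m = profile_integral_bounds[OF G, of a]
  have "integral {a..a+1} G \<le> G x" if "x \<le> a" for x
    using m(1) D(1)[OF that] by simp
  moreover have "G x \<le> integral {a..a+1} G" if "a + 1 \<le> x" for x
    using m(2) D(1)[OF that] by simp
  moreover have "integral {a..a+1} G \<le> n" "0 \<le> integral {a..a+1} G"
    using m D(3,4)[of a] D(3)[of "a+1"] by linarith+
  ultimately show ?thesis
    unfolding profile_def antimono_def level_def using D by auto
qed

lemma integral_level_right:
  assumes G: "profile n z G" and "a + 1 \<le> y"
  shows "integral {y..L} G \<le> integral {y..L} (level n z a G)"
proof (intro integral_le profile_integrable_on[OF G] profile_integrable_on[OF profile_level[OF G]])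
  fix x assume "x \<in> {y..L}"
  then show "G x \<le> level n z a G x"
    using assms profileD(4)[OF G] profile_integral_bounds(2)[OF G, of a]
    by (auto simp: level_def dest!: order_antisym[of x "a + 1"])
qed

text \<open>The left side is the chord over \<open>[a, a + 1]\<close> of the tail integral of
  \<open>G\<close>, the counterpart of the bound in \<open>excess_seq_Suc_inside\<close>.\<close>

lemma integral_level_inside:
  assumes G: "profile n z G" and y: "a \<le> y" "y \<le> a + 1" "a + 1 \<le> L"
  shows "(a + 1 - y) * integral {a..a+1} G + integral {a+1..L} G \<le> integral {y..L} (level n z a G)"
proof -
  note G' = profile_level[OF G, of a]
  have mn: "integral {a..a+1} G \<le> n"
    using profile_integral_bounds(1)[OF G, of a] profileD(4)[OF G, of a] by simp
  have "integral {y..a+1} (\<lambda>_. integral {a..a+1} G) \<le> integral {y..a+1} (level n z a G)"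
    using y mn by (intro integral_le profile_integrable_on[OF G']) (auto simp: level_def)
  then show ?thesis
    using y integral_level_right[OF G order_refl, of a L] profile_integral_split[OF G' y(2,3)]
    by simp
qed

text \<open>Averaging preserves the integral over \<open>[a, a + 1]\<close>, and resetting to
  \<open>n\<close> can only raise it.\<close>

lemma integral_level_left:
  assumes G: "profile n z G" and y: "y \<le> a" "a + 1 \<le> L"
  shows "integral {y..L} G \<le> integral {y..L} (level n z a G)"
proof -
  note G' = profile_level[OF G, of a]
  have "integral {y..a} (level n z a G) = integral {y..a} G"
    using profileD(2)[OF G] by (intro integral_spike[of "{a}"]) (auto simp: level_def)
  moreover have "integral {a..L} G \<le> integral {a..L} (level n z a G)"
    using integral_level_inside[OF G order_refl _ y(2)] profile_integral_split[OF G _ y(2), of a]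
    by simp
  ultimately show ?thesis
    using y profile_integral_split[OF G, of y a L] profile_integral_split[OF G', of y a L] by simp
qed

section \<open>The energy of a profile\<close>

text \<open>Here \<open>n = s^3\<close>. The part \<open>g * (2 * s^3 - g)\<close> is concave with
  its peak at \<open>g = s^3\<close>, which favours averaging and resetting; the penalty lets an
  upper bound on the energy control the first moment.\<close>

definition energy_density :: "real \<Rightarrow> real \<Rightarrow> (real \<Rightarrow> real) \<Rightarrow> real \<Rightarrow> real" where
  "energy_density s z G y = G y * (2 * s^3 - G y - 6 * s^2 * max 0 (y - z))"

lemma energy_density_integrable_on:
  assumes G: "profile n z G"
  shows "energy_density s z' G integrable_on {a..b}"
proof -
  have "(\<lambda>y. (2 * s^3 - 6 * s^2 * max 0 (y - z')) * G y) integrable_on {a..b}"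
    by (intro continuous_times_profile_integrable_on[OF G] continuous_intros)
  moreover have "(\<lambda>y. G y * G y) integrable_on {a..b}"
  proof (rule bounded_measurable_integrable_on)
    show "(\<lambda>y. G y * G y) \<in> borel_measurable borel"
      using profile_measurable[OF G] by measurable
    show "\<bar>G y * G y\<bar> \<le> n * n" for y
      using profileD(3,4)[OF G, of y] by (simp add: mult_mono')
  qed
  ultimately have "(\<lambda>y. (2 * s^3 - 6 * s^2 * max 0 (y - z')) * G y - G y * G y) integrable_on {a..b}"
    by (rule integrable_diff)
  moreover have "(\<lambda>y. (2 * s^3 - 6 * s^2 * max 0 (y - z')) * G y - G y * G y) = energy_density s z' G"
    by (rule ext) (simp add: energy_density_def algebra_simps)
  ultimately show ?thesis
    by simp
qed

lemma integral_centered_square: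
  "((\<lambda>y. (y - (a + 1/2))^2) has_integral 1/12) {a..a+1::real}"
proof -
  have "((\<lambda>y. (y - (a + 1/2))^2) has_integral
      ((a + 1) - (a + 1/2))^3 / 3 - (a - (a + 1/2))^3 / 3) {a..a+1}"
    by (rule fundamental_theorem_of_calculus)
      (auto intro!: derivative_eq_intros simp flip: has_real_derivative_iff_has_vector_derivative)
  then show ?thesis
    by (simp add: power3_eq_cube)
qed

text \<open>Completing the square in \<open>G y - m\<close>, with \<open>m\<close> the average of \<open>G\<close>, bounds the energy lost by averaging;
  \<open>k\<close> is the weight at the midpoint, and the terms linear in \<open>G y - m\<close> integrate to 0.\<close>

lemma energy_density_level_ge:
  fixes a z s :: real
  defines "k \<equiv> max 0 (a + 1/2 - z)"
  assumes G: "profile (s^3) z G"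
  shows "energy_density s z G y + (if y \<in> {a..a+1} then
      (2 * s^3 - 2 * integral {a..a+1} G - 6 * s^2 * k) * (integral {a..a+1} G - G y)
      - 9 * s^4 * (y - (a + 1/2))^2 else 0)
    \<le> energy_density s z (level (s^3) z a G) y"
proof (cases "y \<in> {a..a+1}")
  case False
  then show ?thesis
    using profileD(2)[OF G] by (auto simp: energy_density_def level_def)
next
  case True
  define m where "m = integral {a..a+1} G"
  define w where "w = max 0 (y - z)"
  define g where "g = G y"
  \<comment> \<open>The weight \<open>w\<close> is 1-Lipschitz in \<open>y\<close>, and
    \<open>k\<close> is its value at the midpoint.\<close>
  have "(w - k)^2 \<le> (y - (a + 1/2))^2"
    by (rule power2_le_iff_abs_le[THEN iffD2, OF abs_ge_zero, simplified]) (auto simp: w_def k_def max_def)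
  then have "9 * s^4 * (w - k)^2 \<le> 9 * s^4 * (y - (a + 1/2))^2"
    by (intro mult_left_mono) auto
  moreover have "m * (2 * s^3 - m - 6 * s^2 * w) - g * (2 * s^3 - g - 6 * s^2 * w)
      = (g - m + 3 * s^2 * (w - k))^2 - 9 * s^4 * (w - k)^2
        + (2 * s^3 - 2 * m - 6 * s^2 * k) * (m - g)"
    by algebra
  ultimately have *: "g * (2 * s^3 - g - 6 * s^2 * w)
      + ((2 * s^3 - 2 * m - 6 * s^2 * k) * (m - g) - 9 * s^4 * (y - (a + 1/2))^2)
      \<le> m * (2 * s^3 - m - 6 * s^2 * w)"
    using zero_le_power2[of "g - m + 3 * s^2 * (w - k)"] by linarith
  show ?thesis
  proof (cases "y \<le> z")
    case yz: True
    \<comment> \<open>Left of \<open>z\<close> the penalty vanishes and the reset value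
      \<open>s^3\<close> maximizes the density.\<close>
    have "0 \<le> (s^3 - m)^2"
      by simp
    also have "(s^3 - m)^2 = s^3 * s^3 - m * (2 * s^3 - m)"
      by algebra
    finally have "m * (2 * s^3 - m - 6 * s^2 * w) \<le> s^3 * (2 * s^3 - s^3 - 6 * s^2 * w)"
      using yz by (simp add: w_def)
    then show ?thesis
      using * True yz by (simp add: energy_density_def level_def w_def[symmetric] m_def[symmetric] g_def[symmetric])
  next
    case False
    then show ?thesis
      using * True by (simp add: energy_density_def level_def w_def[symmetric] m_def[symmetric] g_def[symmetric])
  qed
qed

text \<open>Integrating the pointwise bound: the linear term vanishes, and the variance
  \<open>1/12\<close> of the unit interval turns \<open>9 * s^4\<close> into
  \<open>3/4 * s^4\<close>.\<close>

lemma energy_level_ge: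
  fixes a z s :: real
  assumes G: "profile (s^3) z G" and ab: "lo \<le> a" "a + 1 \<le> hi"
  shows "integral {lo..hi} (energy_density s z G) - 3/4 * s^4
    \<le> integral {lo..hi} (energy_density s z (level (s^3) z a G))"
proof -
  define m where "m = integral {a..a+1} G"
  define K where "K = 2 * s^3 - 2 * m - 6 * s^2 * max 0 (a + 1/2 - z)"
  define p where "p = (\<lambda>y. K * (m - G y) - 9 * s^4 * (y - (a + 1/2))^2)"
  have "(G has_integral m) {a..a+1}"
    unfolding m_def using profile_integrable_on[OF G] by (rule integrable_integral)
  moreover have "((\<lambda>_. m) has_integral m) {a..a+1}"
    using has_integral_const_real[of m a "a + 1"] by simp
  ultimately have "(p has_integral (K * (m - m) - 9 * s^4 * (1/12))) {a..a+1}"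
    unfolding p_def
    by (intro has_integral_diff has_integral_mult_right integral_centered_square)
  then have p: "(p has_integral (- (3/4 * s^4))) {a..a+1}"
    by simp
  have Int: "{a..a+1} \<inter> {lo..hi} = {a..a+1}"
    using ab by auto
  have "((\<lambda>y. if y \<in> {a..a+1} then p y else 0) has_integral (- (3/4 * s^4))) {lo..hi}"
    unfolding has_integral_restrict_Int Int by (rule p)
  with energy_density_integrable_on[OF G]
  have "((\<lambda>y. energy_density s z G y + (if y \<in> {a..a+1} then p y else 0)) has_integral
      (integral {lo..hi} (energy_density s z G) + (- (3/4 * s^4)))) {lo..hi}"
    by (intro has_integral_add integrable_integral)
  moreover have "(energy_density s z (level (s^3) z a G) has_integral
      integral {lo..hi} (energy_density s z (level (s^3) z a G))) {lo..hi}"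
    using energy_density_integrable_on[OF profile_level[OF G]] by (rule integrable_integral)
  ultimately have "integral {lo..hi} (energy_density s z G) + (- (3/4 * s^4))
    \<le> integral {lo..hi} (energy_density s z (level (s^3) z a G))"
    unfolding p_def K_def m_def
    by (rule has_integral_le) (rule energy_density_level_ge[OF G])
  then show ?thesis
    by simp
qed

section \<open>Bounding the energy by the first moment\<close>

lemma integral_positive_part_square:
  fixes s z :: real
  assumes "s > 0" "z + 4/3 * s \<le> L"
  shows "((\<lambda>y. (max 0 (s^3 - 3/4 * s^2 * max 0 (y - z)))^2) has_integral (s^6 + 4/9 * s^7)) {z-1..L}"
proof -
  let ?f = "\<lambda>y. (max 0 (s^3 - 3/4 * s^2 * max 0 (y - z)))^2"
  have "((\<lambda>_. s^6) has_integral s^6) {z-1..z}"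
    using has_integral_const_real[of "s^6" "z - 1" z] by simp
  then have 1: "(?f has_integral s^6) {z-1..z}"
    by (rule has_integral_eq[rotated]) (use assms in \<open>auto simp: max_def simp flip: power_mult\<close>)
  have "((\<lambda>y. (s^3 - 3/4 * s^2 * (y - z))^2) has_integral
      - ((s^3 - 3/4 * s^2 * ((z + 4/3 * s) - z))^3 / (9/4 * s^2))
      - - ((s^3 - 3/4 * s^2 * (z - z))^3 / (9/4 * s^2))) {z..z + 4/3 * s}"
    using assms
    by (intro fundamental_theorem_of_calculus)
      (auto intro!: derivative_eq_intros simp: field_simps simp flip: has_real_derivative_iff_has_vector_derivative)
  moreover have "- ((s^3 - 3/4 * s^2 * ((z + 4/3 * s) - z))^3 / (9/4 * s^2))
      - - ((s^3 - 3/4 * s^2 * (z - z))^3 / (9/4 * s^2)) = 4/9 * s^7"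
    using assms by (simp add: field_simps power_numeral_reduce)
  ultimately have "((\<lambda>y. (s^3 - 3/4 * s^2 * (y - z))^2) has_integral 4/9 * s^7) {z..z + 4/3 * s}"
    by (simp only:)
  then have 2: "(?f has_integral 4/9 * s^7) {z..z + 4/3 * s}"
  proof (rule has_integral_eq[rotated])
    fix y assume y: "y \<in> {z..z + 4/3 * s}"
    have "3/4 * s^2 * (y - z) \<le> 3/4 * s^2 * (4/3 * s)"
      using y by (intro mult_left_mono) auto
    also have "\<dots> = s^3"
      by (simp add: power_numeral_reduce)
    finally show "(s^3 - 3/4 * s^2 * (y - z))^2 = ?f y"
      using y by (simp add: max_def)
  qed
  have 3: "(?f has_integral 0) {z + 4/3 * s..L}"
  proof (rule has_integral_is_0)
    fix y assume y: "y \<in> {z + 4/3 * s..L}"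
    have "s^3 = 3/4 * s^2 * (4/3 * s)"
      by (simp add: power_numeral_reduce)
    also have "\<dots> \<le> 3/4 * s^2 * (y - z)"
      using y by (intro mult_left_mono) auto
    finally show "?f y = 0"
      using y assms by simp
  qed
  have "(?f has_integral (s^6 + 4/9 * s^7)) {z-1..z + 4/3 * s}"
    using assms by (intro has_integral_combine[OF _ _ 1 2]) auto
  then have "(?f has_integral (s^6 + 4/9 * s^7 + 0)) {z-1..L}"
    using assms by (intro has_integral_combine[OF _ _ _ 3]) auto
  then show ?thesis
    by simp
qed

text \<open>The penalty coefficient 6 is split as \<open>3/2 + 9/2\<close>. The first share stays
  with \<open>2 * s^3\<close> to form \<open>2 * q\<close>, and \<open>g * (2 * q - g)\<close> is at
  most \<open>(max 0 q)^2\<close> for \<open>g \<ge> 0\<close>; the second share yields the first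
  moment.\<close>

lemma energy_le:
  fixes s z :: real
  assumes G: "profile (s^3) z G" and "s > 0" "z + 4/3 * s \<le> L"
  shows "integral {z-1..L} (energy_density s z G)
    \<le> s^6 + 4/9 * s^7 - 9/2 * s^2 * integral {z-1..L} (\<lambda>y. max 0 (y - z) * G y)"
proof -
  have "(\<lambda>y. max 0 (y - z) * G y) integrable_on {z-1..L}"
    by (intro continuous_times_profile_integrable_on[OF G] continuous_intros)
  then have upper: "((\<lambda>y. (max 0 (s^3 - 3/4 * s^2 * max 0 (y - z)))^2 - 9/2 * s^2 * (max 0 (y - z) * G y)) has_integral
      s^6 + 4/9 * s^7 - 9/2 * s^2 * integral {z-1..L} (\<lambda>y. max 0 (y - z) * G y)) {z-1..L}"
    by (intro has_integral_diff has_integral_mult_right integral_positive_part_square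
        integrable_integral assms)
  have lower: "(energy_density s z G has_integral integral {z-1..L} (energy_density s z G)) {z-1..L}"
    using energy_density_integrable_on[OF G] by (rule integrable_integral)
  have pointwise: "energy_density s z G y
      \<le> (max 0 (s^3 - 3/4 * s^2 * max 0 (y - z)))^2 - 9/2 * s^2 * (max 0 (y - z) * G y)" for y
  proof -
    define w where "w = max 0 (y - z)"
    define q where "q = s^3 - 3/4 * s^2 * w"
    define g where "g = G y"
    have "g * (2 * q - g) \<le> (max 0 q)^2"
    proof (cases "q \<le> 0")
      case True
      then have "g * (2 * q - g) \<le> 0"
        using profileD(3)[OF G, of y] by (intro mult_nonneg_nonpos) (auto simp: g_def)
      then show ?thesis
        by (rule order_trans) simp
    next
      case False
      have "0 \<le> (q - g)^2"
        by simp
      also have "(q - g)^2 = q^2 - g * (2 * q - g)"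
        by algebra
      finally show ?thesis
        using False by simp
    qed
    moreover have "g * (2 * s^3 - g - 6 * s^2 * w) = g * (2 * q - g) - 9/2 * s^2 * (w * g)"
      unfolding q_def by (simp add: algebra_simps)
    ultimately show ?thesis
      unfolding energy_density_def w_def[symmetric] g_def[symmetric] q_def[symmetric] by linarith
  qed
  show ?thesis
    by (rule has_integral_le[OF lower upper pointwise])
qed

text \<open>A staircase with steps of height \<open>e\<close> at \<open>z + e\<close> and
  \<open>z + 2 * e\<close> lies below \<open>max 0 (y - z)\<close>. This leaves only tail integrals,
  which domination controls.\<close>

lemma first_moment_ge:
  assumes G: "profile n z G" and e: "e \<ge> 0"
  shows "e * integral {z+e..L} G + e * integral {z+2*e..L} G
    \<le> integral {z-1..L} (\<lambda>y. max 0 (y - z) * G y)"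
proof -
  have tail: "((\<lambda>y. if y \<in> {z+c..L} then e * G y else 0) has_integral e * integral {z+c..L} G) {z-1..L}"
    if "c \<ge> 0" for c
  proof -
    have Int: "{z+c..L} \<inter> {z-1..L} = {z+c..L}"
      using that by auto
    show ?thesis
      unfolding has_integral_restrict_Int Int
      by (intro has_integral_mult_right integrable_integral profile_integrable_on[OF G])
  qed
  have lower: "((\<lambda>y. (if y \<in> {z+e..L} then e * G y else 0) + (if y \<in> {z+2*e..L} then e * G y else 0)) has_integral
      e * integral {z+e..L} G + e * integral {z+2*e..L} G) {z-1..L}"
    using e by (intro has_integral_add tail) auto
  have upper: "((\<lambda>y. max 0 (y - z) * G y) has_integral integral {z-1..L} (\<lambda>y. max 0 (y - z) * G y)) {z-1..L}"
    by (intro integrable_integral continuous_times_profile_integrable_on[OF G] continuous_intros)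
  have pointwise: "(if y \<in> {z+e..L} then e * G y else 0) + (if y \<in> {z+2*e..L} then e * G y else 0)
      \<le> max 0 (y - z) * G y" for y
  proof -
    have "(if y \<in> {z+e..L} then e else 0) + (if y \<in> {z+2*e..L} then e else 0) \<le> max 0 (y - z)"
      using e by auto
    from mult_right_mono[OF this profileD(3)[OF G, of y]] show ?thesis
      by (auto simp: distrib_right split: if_splits)
  qed
  show ?thesis
    by (rule has_integral_le[OF lower upper pointwise])
qed

section \<open>Domination by a profile\<close>

lemma dominating_profile_exists:
  assumes valid: "valid_seq mu0 vs" and "excess mu0 (z - 1) = 0" and s: "s > 0"
    and mass_le: "\<And>i. i \<le> length vs \<Longrightarrow> mass (seq_dist mu0 vs i) {z-1<..} \<le> s^3"
    and "z \<le> L" and L: "\<And>v. v \<in> set vs \<Longrightarrow> fst v + 1 \<le> L"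
    and "i \<le> length vs"
  shows "\<exists>G. profile (s^3) z G
    \<and> (\<forall>y\<in>{z..L}. excess (seq_dist mu0 vs i) y \<le> integral {y..L} G)
    \<and> s^6 - 3/4 * s^4 * moves_beyond vs (z - 1) i \<le> integral {z-1..L} (energy_density s z G)"
  using \<open>i \<le> length vs\<close>
proof (induction i)
  case 0
  \<comment> \<open>Mass never counts right of \<open>z\<close> at the start; the energy
    \<open>s^6\<close> comes from \<open>[z - 1, z]\<close> alone.\<close>
  define G where "G = (\<lambda>y. if y \<le> z then s^3 else 0)"
  have G: "profile (s^3) z G"
    using s by (auto simp: profile_def antimono_def G_def)
  have "is_dist mu0"
    using valid_seq_is_dist[OF valid, of 0] by (simp add: seq_dist_0)
  then have "excess mu0 y \<le> integral {y..L} G" if "z \<le> y" for y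
    using excess_antimono[of mu0 "z - 1" y] that assms(2)
      integral_nonneg[OF profile_integrable_on[OF G] profileD(3)[OF G], of y L]
    by simp
  moreover have "(energy_density s z G has_integral s^6) {z-1..L}"
  proof -
    have Int: "{z-1..z} \<inter> {z-1..L} = {z-1..z}"
      using \<open>z \<le> L\<close> by auto
    have "((\<lambda>y. if y \<in> {z-1..z} then s^6 else 0) has_integral s^6) {z-1..L}"
      unfolding has_integral_restrict_Int Int
      using has_integral_const_real[of "s^6" "z - 1" z] by simp
    then show ?thesis
      by (rule has_integral_eq[rotated]) (auto simp: energy_density_def G_def simp flip: power_add)
  qed
  ultimately show ?case
    using G by (intro exI[of _ G]) (simp add: seq_dist_0 moves_beyond_0 integral_unique)
next
  case (Suc i)
  let ?mu = "seq_dist mu0 vs i" and ?mu' = "seq_dist mu0 vs (Suc i)"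
  define a where "a = fst (vs ! i)"
  have i: "i < length vs"
    using Suc.prems by simp
  have aL: "a + 1 \<le> L"
    unfolding a_def using L i by simp
  note outside = excess_seq_Suc_outside[OF valid i, folded a_def]
  note inside = excess_seq_Suc_inside[OF valid i, folded a_def]
  obtain G where G: "profile (s^3) z G"
    and dom: "\<And>y. y \<in> {z..L} \<Longrightarrow> excess ?mu y \<le> integral {y..L} G"
    and energy: "s^6 - 3/4 * s^4 * moves_beyond vs (z - 1) i \<le> integral {z-1..L} (energy_density s z G)"
    using Suc i by auto
  show ?case
  proof (cases "a + 1 \<le> z")
    case True
    \<comment> \<open>A move ending by \<open>z\<close> leaves the excess on \<open>[z, L]\<close>
      unchanged, so the profile is kept.\<close>
    have "excess ?mu' y \<le> integral {y..L} G" if "y \<in> {z..L}" for y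
      using dom[OF that] outside[of y] that True by simp
    moreover have "3/4 * s^4 * moves_beyond vs (z - 1) i \<le> 3/4 * s^4 * moves_beyond vs (z - 1) (Suc i)"
      by (intro mult_left_mono) (auto simp: moves_beyond_Suc)
    then have "s^6 - 3/4 * s^4 * moves_beyond vs (z - 1) (Suc i)
        \<le> integral {z-1..L} (energy_density s z G)"
      using energy by linarith
    ultimately show ?thesis
      using G by blast
  next
    case False
    define G' where "G' = level (s^3) z a G"
    have az: "z - 1 < a"
      using False by simp
    \<comment> \<open>Domination extends to \<open>[z - 1, z]\<close>, where the excess has slope at
      least \<open>- s^3\<close> and \<open>G\<close> equals \<open>s^3\<close>. This covers the
      left end \<open>a\<close> of the move.\<close>
    have dom_left: "excess ?mu y \<le> integral {y..L} G" if y: "z - 1 \<le> y" "y \<le> z" for y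
    proof -
      have mu: "is_dist ?mu"
        using valid_seq_is_dist[OF valid] i by simp
      have "mass ?mu {y<..} \<le> s^3"
        using mass_antimono[OF mu y(1)] mass_le[of i] i by simp
      then have "(z - y) * mass ?mu {y<..} \<le> (z - y) * s^3"
        using y by (intro mult_left_mono) auto
      moreover have "integral {y..z} G = (z - y) * s^3"
        using y profileD(2)[OF G] integral_cong[of "{y..z}" G "\<lambda>_. s^3"] by simp
      ultimately show ?thesis
        using excess_le_mass[OF mu y(2)] dom[of z] \<open>z \<le> L\<close>
          profile_integral_split[OF G y(2) \<open>z \<le> L\<close>] by simp
    qed
    have dom': "excess ?mu y \<le> integral {y..L} G" if "z - 1 \<le> y" "y \<le> L" for y
      using dom[of y] dom_left[of y] that by (cases "y \<le> z") auto
    have "excess ?mu' y \<le> integral {y..L} G'" if y: "y \<in> {z..L}" for y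
    proof -
      consider "a + 1 \<le> y" | "y \<le> a" | "a \<le> y" "y \<le> a + 1"
        by linarith
      then show ?thesis
      proof cases
        case 1
        then show ?thesis
          using outside[of y] dom[OF y] integral_level_right[OF G, of a y L] by (simp add: G'_def)
      next
        case 2
        then show ?thesis
          using outside[of y] dom[OF y] integral_level_left[OF G, of y a L] aL by (simp add: G'_def)
      next
        case 3
        have "excess ?mu' y \<le> (a + 1 - y) * excess ?mu a + (y - a) * excess ?mu (a + 1)"
          by (rule inside[OF 3])
        also have "\<dots> \<le> (a + 1 - y) * (integral {a..a+1} G + integral {a+1..L} G)
            + (y - a) * integral {a+1..L} G"
          using dom'[of a] dom'[of "a + 1"] profile_integral_split[OF G _ aL, of a] az aL 3
          by (intro add_mono mult_left_mono) auto
        also have "\<dots> = (a + 1 - y) * integral {a..a+1} G + integral {a+1..L} G"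
          by (simp add: algebra_simps)
        also have "\<dots> \<le> integral {y..L} G'"
          unfolding G'_def by (rule integral_level_inside[OF G 3 aL])
        finally show ?thesis .
      qed
    qed
    moreover have "center (vs ! i) > z - 1"
      using az by (simp add: center_def a_def)
    then have "s^6 - 3/4 * s^4 * moves_beyond vs (z - 1) (Suc i)
        \<le> integral {z-1..L} (energy_density s z G')"
      using energy energy_level_ge[OF G _ aL, of "z - 1"] az
      by (simp add: moves_beyond_Suc G'_def distrib_left)
    moreover have "profile (s^3) z G'"
      unfolding G'_def by (rule profile_level[OF G])
    ultimately show ?thesis
      by blast
  qed
qed

section \<open>Reducing the mass by a factor of 8, and iteration\<close>

lemma mass_beyond_triple_le:
  assumes valid: "valid_seq mu0 vs" and wc: "weight_constrained mu0 vs"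
    and "excess mu0 r = 0" and s: "s \<ge> 9/4" and max_le: "mu_max mu0 vs {r<..} \<le> s^3"
  shows "mu_max mu0 vs {r + 3 * s<..} \<le> (s / 2)^3"
  unfolding mu_max_le_iff
proof (intro allI impI, rule ccontr)
  fix i assume i: "i \<le> length vs"
  let ?mu = "seq_dist mu0 vs i"
  assume "\<not> mass ?mu {r + 3 * s<..} \<le> (s / 2)^3"
  then have big: "s^3 / 8 \<le> mass ?mu {r + 3 * s<..}"
    by (simp add: power_divide)
  \<comment> \<open>An interval reaching beyond \<open>z\<close> then starts beyond
    \<open>r\<close>, where the tail mass is at most \<open>s^3\<close>.\<close>
  define z where "z = r + 1"
  define L where "L = Max (insert (z + 3 * s) ((\<lambda>v. fst v + 1) ` set vs))"
  have L: "z + 3 * s \<le> L" "\<And>v. v \<in> set vs \<Longrightarrow> fst v + 1 \<le> L"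
    unfolding L_def by auto
  have mu: "is_dist ?mu"
    by (rule valid_seq_is_dist[OF valid i])
  obtain G where G: "profile (s^3) z G"
    and dom: "\<And>y. y \<in> {z..L} \<Longrightarrow> excess ?mu y \<le> integral {y..L} G"
    and energy: "s^6 - 3/4 * s^4 * moves_beyond vs r i \<le> integral {z-1..L} (energy_density s z G)"
    using dominating_profile_exists[OF valid, of z s L i] assms L i
      order_trans[OF mass_le_mu_max max_le] by (auto simp: z_def)
  \<comment> \<open>Chosen so that \<open>z + 3 * e = r + 3 * s\<close>. The next bound holds
    because \<open>1/3 \<le> 4/27 * s\<close> for \<open>s \<ge> 9/4\<close>.\<close>
  define e where "e = s - 1/3"
  have e: "e \<ge> 23/27 * s"
    using s by (simp add: e_def)
  have tail: "s^3 / 8 * (3 * e - c) \<le> integral {z+c..L} G" if c: "0 \<le> c" "c \<le> 3 * e" for c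
  proof -
    have "s^3 / 8 * (3 * e - c) \<le> mass ?mu {r + 3 * s<..} * (3 * e - c)"
      using big c by (intro mult_right_mono) auto
    also have "\<dots> = (r + 3 * s - (z + c)) * mass ?mu {r + 3 * s<..}"
      by (simp add: e_def z_def algebra_simps)
    also have "\<dots> \<le> excess ?mu (z + c)"
      using c by (intro mass_le_excess[OF mu]) (simp add: e_def z_def)
    also have "\<dots> \<le> integral {z+c..L} G"
      using c L(1) by (intro dom) (simp add: e_def)
    finally show ?thesis .
  qed
  define A where "A = integral {z-1..L} (\<lambda>y. max 0 (y - z) * G y)"
  have "e * (s^3 / 8 * (2 * e)) + e * (s^3 / 8 * e) \<le> e * integral {z+e..L} G + e * integral {z+2*e..L} G"
    using tail[of e] tail[of "2 * e"] e s by (intro add_mono mult_left_mono) auto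
  also have "\<dots> \<le> A"
    unfolding A_def using e s by (intro first_moment_ge[OF G]) simp
  finally have "3/8 * s^3 * e^2 \<le> A"
    by (simp add: power2_eq_square algebra_simps)
  moreover have "3/8 * s^3 * (23/27 * s)^2 \<le> 3/8 * s^3 * e^2"
    using e s by (intro mult_left_mono power_mono) auto
  ultimately have "529/1944 * s^5 \<le> A"
    by (simp add: power_numeral_reduce algebra_simps)
  then have "9/2 * s^2 * (529/1944 * s^5) \<le> 9/2 * s^2 * A"
    by (intro mult_left_mono) auto
  then have "529/432 * s^7 \<le> 9/2 * s^2 * A"
    by (simp add: power_numeral_reduce algebra_simps)
  moreover have "s^6 - 3/4 * s^4 * moves_beyond vs r i \<le> s^6 + 4/9 * s^7 - 9/2 * s^2 * A"
    using energy energy_le[OF G, of L] s L(1) by (simp add: A_def)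
  moreover have "3/4 * s^4 * moves_beyond vs r i \<le> 3/4 * s^4 * s^3"
    using moves_beyond_le_mu_max[OF wc i, of r] max_le by (intro mult_left_mono) auto
  then have "3/4 * s^4 * moves_beyond vs r i \<le> 3/4 * s^7"
    by (simp flip: power_add)
  moreover have "s^7 > 0"
    using s by simp
  \<comment> \<open>The terms \<open>s^6\<close> cancel, and \<open>529/432\<close> exceeds
    \<open>3/4 + 4/9 = 516/432\<close>.\<close>
  ultimately show False
    by linarith
qed

text \<open>Here \<open>k\<close> bounds the number of halvings of \<open>s\<close>. The target is
  invariant under a halving, since \<open>3 * s + 6 * (s / 2) = 6 * s\<close>.\<close>

lemma excess_beyond_eq_0:
  assumes valid: "valid_seq mu0 vs" and wc: "weight_constrained mu0 vs"
    and "excess mu0 r = 0" and "s \<ge> 1/2" and "mu_max mu0 vs {r<..} \<le> s^3"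
    and "s \<le> 9/4 * 2^k" and "i \<le> length vs"
  shows "excess (seq_dist mu0 vs i) (r + 6 * s - 1) = 0"
  using assms(3-6)
proof (induction k arbitrary: r s)
  case 0
  \<comment> \<open>On \<open>[1/2, 9/4]\<close> the cube lies below its chord; the factor
    \<open>s + 11/4\<close> makes the three roots sum to 0, so no square term arises.\<close>
  have "(s - 1/2) * (s - 9/4) \<le> 0"
    using 0 by (intro mult_nonneg_nonpos) auto
  then have "(s + 11/4) * ((s - 1/2) * (s - 9/4)) \<le> 0"
    using 0 by (intro mult_nonneg_nonpos) auto
  moreover have "(s + 11/4) * ((s - 1/2) * (s - 9/4)) = s^3 - 103/16 * s + 99/32"
    by (simp add: power3_eq_cube field_simps)
  ultimately have "s^3 + 3/2 \<le> 6 * s"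
    using 0 by simp
  then have "r + 1/2 + moves_beyond vs r i \<le> r + 6 * s - 1"
    using moves_beyond_le_mu_max[OF wc assms(7), of r] 0 by simp
  then show ?case
    by (rule excess_beyond_moves_eq_0[OF valid 0(1) assms(7)])
next
  case (Suc k)
  show ?case
  proof (cases "s \<le> 9/4 * 2^k")
    case True
    then show ?thesis
      using Suc by simp
  next
    case False
    moreover have "(9/4 :: real) * 1 \<le> 9/4 * 2^k"
      by (intro mult_left_mono) auto
    ultimately have s: "s \<ge> 9/4"
      by linarith
    have "is_dist mu0"
      using valid_seq_is_dist[OF valid, of 0] by (simp add: seq_dist_0)
    then have "excess mu0 (r + 3 * s) = 0"
      using excess_antimono[of mu0 r "r + 3 * s"] excess_nonneg[of mu0 "r + 3 * s"] Suc.prems(1) s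
      by simp
    moreover have "mu_max mu0 vs {r + 3 * s<..} \<le> (s / 2)^3"
      using Suc.prems by (intro mass_beyond_triple_le[OF valid wc _ s])
    ultimately have "excess (seq_dist mu0 vs i) (r + 3 * s + 6 * (s / 2) - 1) = 0"
      using s Suc.prems by (intro Suc.IH) auto
    then show ?thesis
      by (simp add: add.commute)
  qed
qed

theorem mainTheorem3:
  fixes r n :: real
    and mu0 :: "real \<Rightarrow> real"
    and vs :: "(real \<times> (real \<Rightarrow> real)) list"
  assumes "n \<ge> 1/5"
    and "valid_seq mu0 vs"
    and "weight_constrained mu0 vs"
    and "mass mu0 {r<..} = 0"
    and "mu_max mu0 vs {r<..} \<le> n"
  shows "mu_max mu0 vs {r + 6 * n powr (1/3) - 1<..} = 0"
proof -
  define s where "s = n powr (1/3)"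
  have s0: "s > 0"
    using assms(1) by (simp add: s_def)
  have s3: "s^3 = n"
    using assms(1) by (simp add: s_def powr_power)
  \<comment> \<open>The base case needs \<open>s \<ge> 1/2\<close>, which follows from
    \<open>1/8 \<le> 1/5 \<le> n\<close>.\<close>
  have "(1/2 :: real)^3 \<le> s^3"
    using assms(1) s3 by (simp add: power3_eq_cube)
  then have s: "s \<ge> 1/2"
    using power_mono_iff[of "1/2" s 3] s0 by simp
  obtain k where "4/9 * s < 2^k"
    using real_arch_pow[of 2 "4/9 * s"] by auto
  then have k: "s \<le> 9/4 * 2^k"
    by simp
  have dist: "is_dist (seq_dist mu0 vs i)" if "i \<le> length vs" for i
    by (rule valid_seq_is_dist[OF assms(2) that])
  have "excess mu0 r = 0"
    using mass_eq_0_iff_excess_eq_0[of mu0 r] dist[of 0] assms(4) by (simp add: seq_dist_0)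
  then have mass_0: "mass (seq_dist mu0 vs i) {r + 6 * s - 1<..} = 0" if "i \<le> length vs" for i
    using excess_beyond_eq_0[OF assms(2,3) _ s _ k that] assms(5) s3
    by (simp add: mass_eq_0_iff_excess_eq_0[OF dist[OF that]])
  show ?thesis
    unfolding s_def[symmetric]
  proof (rule antisym)
    show "mu_max mu0 vs {r + 6 * s - 1<..} \<le> 0"
      using mass_0 by (simp add: mu_max_le_iff)
    show "0 \<le> mu_max mu0 vs {r + 6 * s - 1<..}"
      using mass_le_mu_max[of 0 vs mu0 "{r + 6 * s - 1<..}"] mass_0[of 0] by simp
  qed
qed

end
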